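(* Let $k$ be a field with $\sqrt{-1}\notin k$. Then the exterior algebra in two variables $A_1=k\langle x_1,x_2\rangle/\langle x_1^2,\ x_2^2,\ x_1x_2+x_2x_1\rangle$ admits no bi-Frobenius algebra structure.
   Context: Bi-Frobenius algebras. Let $A$ be a finite-dimensional algebra that is also a coalgebra over a field $k$ (no compatibility assumed), with comultiplication $\Delta$ and counit $\varepsilon$; let $t\in A$, $\phi\in A^*=\mathrm{Hom}_k(A,k)$, and let $S:A\to A$ be the linear map $S(a)=\sum\phi(t_1a)t_2$, where $\Delta(t)=\sum t_1\otimes t_2$. The quadruple $(A,\phi,t,S)$ is a bi-Frobenius algebra if: (i) $\varepsilon$ is an algebra homomorphism and $1_A$ is group-like; (ii) $(A,\phi)$ is a Frobenius algebra, i.e. $A^*=A\rightharpoonup\phi$ where $(a\rightharpoonup\phi)(x)=\phi(xa)$, and $(A,t)$ is a Frobenius coalgebra, i.e. $A=t\leftharpoonup A^*$ where $t\leftharpoonup f=\sum f(t_1)t_2$; (iii) $S$ is an algebra anti-homomorphism and a coalgebra anti-homomorphism (i.e. $\varepsilon\circ S=\varepsilon$ and $\Delta(S(a))=\sum S(a_2)\otimes S(a_1)$ for all $a\in A$). An algebra "admits a bi-Frobenius algebra structure" if there are $\Delta,\varepsilon,\phi,t$ making it a bi-Frobenius algebra. *)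

theory Defs
  imports Complex_Main "HOL-Library.Poly_Mapping"
begin

section \<open>Formal linear combinations and tensor products\<close>

text \<open>
  The type \<^typ>\<open>'p \<Rightarrow>\<^sub>0 'k\<close> is the free vector space on \<^typ>\<open>'p\<close>; the basis vector \<open>p\<close> is
  \<open>Poly_Mapping.single p 1\<close>.
\<close>

definition fscale :: "'k::field \<Rightarrow> ('p \<Rightarrow>\<^sub>0 'k) \<Rightarrow> ('p \<Rightarrow>\<^sub>0 'k)" where
  "fscale c u = Poly_Mapping.map ((*) c) u"

lemma lookup_fscale [simp]:
  "Poly_Mapping.lookup (fscale c u) p = c * Poly_Mapping.lookup u p"
  unfolding fscale_def by transfer (simp add: when_def)

global_interpretation fsum: vector_space "fscale :: 'k::field \<Rightarrow> ('p \<Rightarrow>\<^sub>0 'k) \<Rightarrow> _"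
  by unfold_locales (auto intro!: poly_mapping_eqI simp: lookup_add algebra_simps)

definition extend_linearly ::
  "('k::field \<Rightarrow> 'v::ab_group_add \<Rightarrow> 'v) \<Rightarrow> ('p \<Rightarrow> 'v) \<Rightarrow> ('p \<Rightarrow>\<^sub>0 'k) \<Rightarrow> 'v" where
  "extend_linearly scale f u =
     (\<Sum>p\<in>Poly_Mapping.keys u. scale (Poly_Mapping.lookup u p) (f p))"

text \<open>
  A slot \<open>g\<close> is a way of completing one tensor factor to a full tuple, for instance
  \<open>\<lambda>x. (x, b)\<close>.  The relations of \<open>g\<close> make the class of \<open>g x\<close> linear in \<open>x\<close>.
\<close>

definition slot_relations ::
  "('k::field \<Rightarrow> 'a::ab_group_add \<Rightarrow> 'a) \<Rightarrow> ('a \<Rightarrow> 'p) \<Rightarrow> ('p \<Rightarrow>\<^sub>0 'k) set" where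
  "slot_relations scale g =
     {Poly_Mapping.single (g (x + y)) 1 - Poly_Mapping.single (g x) 1
        - Poly_Mapping.single (g y) 1 | x y. True}
   \<union> {Poly_Mapping.single (g (scale c x)) 1 - fscale c (Poly_Mapping.single (g x) 1) | c x. True}"

text \<open>
  \<open>A \<otimes> A\<close> is the free vector space on \<open>A \<times> A\<close> modulo the bilinearity relations, and
  \<open>A \<otimes> A \<otimes> A\<close> is the free vector space on \<open>A \<times> A \<times> A\<close> modulo the trilinearity relations.
  Tensors are handled through representatives: \<open>tensor2_eq\<close> and \<open>tensor3_eq\<close> say that two formal
  sums represent the same element of the respective quotient.
\<close>

definition tensor2_eq ::
  "('k::field \<Rightarrow> 'a::ab_group_add \<Rightarrow> 'a) \<Rightarrow> ('a \<times> 'a \<Rightarrow>\<^sub>0 'k) \<Rightarrow> ('a \<times> 'a \<Rightarrow>\<^sub>0 'k) \<Rightarrow> bool" where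
  "tensor2_eq scale u v \<longleftrightarrow>
     u - v \<in> fsum.span (\<Union>b. slot_relations scale (\<lambda>x. (x, b)) \<union> slot_relations scale (\<lambda>x. (b, x)))"

definition tensor3_eq ::
  "('k::field \<Rightarrow> 'a::ab_group_add \<Rightarrow> 'a) \<Rightarrow> ('a \<times> 'a \<times> 'a \<Rightarrow>\<^sub>0 'k) \<Rightarrow> ('a \<times> 'a \<times> 'a \<Rightarrow>\<^sub>0 'k) \<Rightarrow> bool" where
  "tensor3_eq scale u v \<longleftrightarrow>
     u - v \<in> fsum.span (\<Union>b c. slot_relations scale (\<lambda>x. (x, b, c))
                          \<union> slot_relations scale (\<lambda>x. (b, x, c))
                          \<union> slot_relations scale (\<lambda>x. (b, c, x)))"


section \<open>Algebras, coalgebras and bi-Frobenius algebras\<close>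

locale fin_dim_algebra = vector_space scale
  for scale :: "'k::field \<Rightarrow> 'a::ring_1 \<Rightarrow> 'a" +
  assumes scale_mult_left: "scale c x * y = scale c (x * y)"
    and scale_mult_right: "x * scale c y = scale c (x * y)"
    and finite_dimensional: "\<exists>B. finite B \<and> span B = UNIV"

text \<open>
  The comultiplication \<open>A \<rightarrow> A \<otimes> A\<close> is given by a choice \<open>\<Delta>\<close> of representatives, so all conditions
  on it are imposed modulo the tensor relations.  The two sides of \<open>coassoc\<close> are
  \<open>(\<Delta> \<otimes> id) (\<Delta> a)\<close> and \<open>(id \<otimes> \<Delta>) (\<Delta> a)\<close>.
\<close>

locale coalgebra = vector_space scale
  for scale :: "'k::field \<Rightarrow> 'a::ab_group_add \<Rightarrow> 'a" +
  fixes \<Delta> :: "'a \<Rightarrow> ('a \<times> 'a \<Rightarrow>\<^sub>0 'k)"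
    and \<epsilon> :: "'a \<Rightarrow> 'k"
  assumes comult_add: "tensor2_eq scale (\<Delta> (a + b)) (\<Delta> a + \<Delta> b)"
    and comult_scale: "tensor2_eq scale (\<Delta> (scale c a)) (fscale c (\<Delta> a))"
    and counit_linear: "Vector_Spaces.linear scale (*) \<epsilon>"
    and coassoc:
      "tensor3_eq scale
         (extend_linearly fscale
            (\<lambda>(x, y). extend_linearly fscale (\<lambda>(x1, x2). Poly_Mapping.single (x1, x2, y) 1) (\<Delta> x)) (\<Delta> a))
         (extend_linearly fscale
            (\<lambda>(x, y). extend_linearly fscale (\<lambda>(y1, y2). Poly_Mapping.single (x, y1, y2) 1) (\<Delta> y)) (\<Delta> a))"
    and counit_left: "extend_linearly scale (\<lambda>(x, y). scale (\<epsilon> x) y) (\<Delta> a) = a"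
    and counit_right: "extend_linearly scale (\<lambda>(x, y). scale (\<epsilon> y) x) (\<Delta> a) = a"

text \<open>
  Expressions such as \<open>\<Sum> \<phi>(t\<^sub>1 a) t\<^sub>2\<close> are linear extensions of maps that are bilinear in
  \<open>(t\<^sub>1, t\<^sub>2)\<close>; they do not depend on the representative chosen for \<open>\<Delta> t\<close>.
\<close>

locale bi_frobenius_algebra = fin_dim_algebra scale + coalgebra scale \<Delta> \<epsilon>
  for scale :: "'k::field \<Rightarrow> 'a::ring_1 \<Rightarrow> 'a"
    and \<Delta> :: "'a \<Rightarrow> ('a \<times> 'a \<Rightarrow>\<^sub>0 'k)"
    and \<epsilon> :: "'a \<Rightarrow> 'k" +
  fixes \<phi> :: "'a \<Rightarrow> 'k"
    and t :: 'a
    and S :: "'a \<Rightarrow> 'a"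
  assumes \<phi>_linear: "Vector_Spaces.linear scale (*) \<phi>"
    and S_eq: "S a = extend_linearly scale (\<lambda>(t1, t2). scale (\<phi> (t1 * a)) t2) (\<Delta> t)"
    and counit_mult: "\<epsilon> (a * b) = \<epsilon> a * \<epsilon> b"
    and counit_one: "\<epsilon> 1 = 1"
    and comult_one: "tensor2_eq scale (\<Delta> 1) (Poly_Mapping.single (1, 1) 1)"
    and frobenius_algebra:
      "{f. Vector_Spaces.linear scale (*) f} = range (\<lambda>a x. \<phi> (x * a))"
    and frobenius_coalgebra:
      "UNIV = (\<lambda>f. extend_linearly scale (\<lambda>(t1, t2). scale (f t1) t2) (\<Delta> t))
                 ` {f. Vector_Spaces.linear scale (*) f}"
    and S_mult: "S (a * b) = S b * S a"
    and S_one: "S 1 = 1"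
    and counit_S: "\<epsilon> (S a) = \<epsilon> a"
    and comult_S:
      "tensor2_eq scale (\<Delta> (S a))
         (extend_linearly fscale (\<lambda>(a1, a2). Poly_Mapping.single (S a2, S a1) 1) (\<Delta> a))"


section \<open>The exterior algebra in two variables\<close>

text \<open>
  Words form a monoid under concatenation, so that \<open>'v list \<Rightarrow>\<^sub>0 'k\<close>, with the convolution product
  of \<^theory>\<open>HOL-Library.Poly_Mapping\<close>, is the free associative algebra on \<open>'v\<close>.
\<close>

instantiation list :: (type) monoid_add
begin
definition zero_list :: "'a list" where "zero_list = []"
definition plus_list :: "'a list \<Rightarrow> 'a list \<Rightarrow> 'a list" where "plus_list = (@)"
instance by intro_classes (simp_all add: zero_list_def plus_list_def)
end

definition two_sided_ideal :: "'r::ring_1 set \<Rightarrow> bool" where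
  "two_sided_ideal I \<longleftrightarrow>
     0 \<in> I \<and> (\<forall>x\<in>I. \<forall>y\<in>I. x - y \<in> I) \<and> (\<forall>x\<in>I. \<forall>r. r * x \<in> I \<and> x * r \<in> I)"

definition ideal_generated :: "'r::ring_1 set \<Rightarrow> 'r set" where
  "ideal_generated R = \<Inter>{I. two_sided_ideal I \<and> R \<subseteq> I}"

datatype var = X1 | X2

definition free_var :: "var \<Rightarrow> (var list \<Rightarrow>\<^sub>0 'k::field)" where
  "free_var v = Poly_Mapping.single [v] 1"

definition exterior_ideal :: "(var list \<Rightarrow>\<^sub>0 'k::field) set" where
  "exterior_ideal = ideal_generated
     {free_var X1 * free_var X1, free_var X2 * free_var X2,
      free_var X1 * free_var X2 + free_var X2 * free_var X1}"

lemma two_sided_ideal_generated: "two_sided_ideal (ideal_generated R)"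
  unfolding two_sided_ideal_def ideal_generated_def by blast

lemma ideal_generated_subset: "R \<subseteq> ideal_generated R"
  unfolding ideal_generated_def by blast

lemma ideal_generated_least: "two_sided_ideal I \<Longrightarrow> R \<subseteq> I \<Longrightarrow> ideal_generated R \<subseteq> I"
  unfolding ideal_generated_def by blast

lemma exterior_ideal_zero: "0 \<in> exterior_ideal"
  and exterior_ideal_diff: "x \<in> exterior_ideal \<Longrightarrow> y \<in> exterior_ideal \<Longrightarrow> x - y \<in> exterior_ideal"
  and exterior_ideal_lmult: "x \<in> exterior_ideal \<Longrightarrow> r * x \<in> exterior_ideal"
  and exterior_ideal_rmult: "x \<in> exterior_ideal \<Longrightarrow> x * r \<in> exterior_ideal"
  using two_sided_ideal_generated unfolding exterior_ideal_def two_sided_ideal_def by blast+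

lemma exterior_ideal_uminus: "x \<in> exterior_ideal \<Longrightarrow> - x \<in> exterior_ideal"
  using exterior_ideal_diff[OF exterior_ideal_zero, of x] by simp

lemma exterior_ideal_add:
  "x \<in> exterior_ideal \<Longrightarrow> y \<in> exterior_ideal \<Longrightarrow> x + y \<in> exterior_ideal"
  using exterior_ideal_diff[of x "- y"] exterior_ideal_uminus[of y] by simp

lemma fscale_conv_mult: "fscale c f = Poly_Mapping.single ([] :: 'v list) c * f"
  unfolding fscale_def by (simp add: mult_map_scale_conv_mult zero_list_def)

lemma fscale_mult_left: "fscale c (f :: 'v list \<Rightarrow>\<^sub>0 'k::field) * g = fscale c (f * g)"
  by (simp add: fscale_conv_mult mult.assoc)

lemma fscale_single: "fscale c (Poly_Mapping.single p d) = Poly_Mapping.single p (c * d)"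
  by (rule poly_mapping_eqI) (simp add: lookup_single when_def)

lemma poly_mapping_add_induct:
  assumes "P 0" "\<And>p c. P (Poly_Mapping.single p c)" "\<And>f g. P f \<Longrightarrow> P g \<Longrightarrow> P (f + g)"
  shows "P (f :: 'p \<Rightarrow>\<^sub>0 'k::ab_group_add)"
proof (induction "card (Poly_Mapping.keys f)" arbitrary: f)
  case 0
  then have "f = 0" by (auto intro!: poly_mapping_eqI simp: in_keys_iff)
  then show ?case using assms(1) by simp
next
  case (Suc n)
  then have "Poly_Mapping.keys f \<noteq> {}" by (metis card.empty nat.distinct(1))
  then obtain p where p: "p \<in> Poly_Mapping.keys f" by blast
  define g where "g = f - Poly_Mapping.single p (Poly_Mapping.lookup f p)"
  have "Poly_Mapping.keys g = Poly_Mapping.keys f - {p}"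
    by (auto simp: g_def in_keys_iff lookup_minus lookup_single when_def split: if_splits)
  then have "P g" using Suc p by simp
  then have "P (g + Poly_Mapping.single p (Poly_Mapping.lookup f p))" by (intro assms)
  then show ?case by (simp add: g_def)
qed

lemma fscale_mult_right: "f * fscale c g = fscale c (f * g)" for f :: "'v list \<Rightarrow>\<^sub>0 'k::field"
proof -
  have "f * Poly_Mapping.single [] c = Poly_Mapping.single [] c * f"
    by (induction f rule: poly_mapping_add_induct)
      (simp_all add: mult_single plus_list_def mult.commute distrib_left distrib_right)
  then show ?thesis by (metis fscale_conv_mult mult.assoc)
qed

lemma lookup_Nil_mult:
  "Poly_Mapping.lookup (f * g) [] = Poly_Mapping.lookup f [] * Poly_Mapping.lookup g []"
  for f g :: "'v list \<Rightarrow>\<^sub>0 'k::field"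
proof (induction f rule: poly_mapping_add_induct)
  case (2 p c)
  show ?case
    by (induction g rule: poly_mapping_add_induct)
      (auto simp: mult_single plus_list_def lookup_single when_def lookup_add algebra_simps)
qed (simp_all add: lookup_add algebra_simps)

lemma one_notin_exterior_ideal: "(1 :: var list \<Rightarrow>\<^sub>0 'k::field) \<notin> exterior_ideal"
proof -
  let ?I = "{f :: var list \<Rightarrow>\<^sub>0 'k. Poly_Mapping.lookup f [] = 0}"
  have "exterior_ideal \<subseteq> ?I" unfolding exterior_ideal_def
    by (rule ideal_generated_least)
      (auto simp: two_sided_ideal_def lookup_minus lookup_add lookup_Nil_mult free_var_def lookup_single)
  moreover have "1 \<notin> ?I" by (simp add: lookup_one zero_list_def)
  ultimately show ?thesis by blast
qed

quotient_type (overloaded) 'k exterior2 =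
  "var list \<Rightarrow>\<^sub>0 'k::field" / "\<lambda>f g. f - g \<in> exterior_ideal"
proof (rule equivpI)
  show "reflp (\<lambda>f g :: var list \<Rightarrow>\<^sub>0 'k. f - g \<in> exterior_ideal)"
    by (simp add: reflp_def exterior_ideal_zero)
  show "symp (\<lambda>f g :: var list \<Rightarrow>\<^sub>0 'k. f - g \<in> exterior_ideal)"
    unfolding symp_def by (metis exterior_ideal_uminus minus_diff_eq)
  show "transp (\<lambda>f g :: var list \<Rightarrow>\<^sub>0 'k. f - g \<in> exterior_ideal)"
  proof (rule transpI)
    fix f g h :: "var list \<Rightarrow>\<^sub>0 'k"
    assume "f - g \<in> exterior_ideal" "g - h \<in> exterior_ideal"
    then have "(f - g) + (g - h) \<in> exterior_ideal" by (rule exterior_ideal_add)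
    then show "f - h \<in> exterior_ideal" by simp
  qed
qed

instantiation exterior2 :: (field) ring_1
begin

lift_definition zero_exterior2 :: "'a exterior2" is 0 .
lift_definition one_exterior2 :: "'a exterior2" is 1 .
lift_definition plus_exterior2 :: "'a exterior2 \<Rightarrow> 'a exterior2 \<Rightarrow> 'a exterior2" is "(+)"
  by (drule (1) exterior_ideal_add) (simp add: algebra_simps)
lift_definition minus_exterior2 :: "'a exterior2 \<Rightarrow> 'a exterior2 \<Rightarrow> 'a exterior2" is "(-)"
  by (drule (1) exterior_ideal_diff) (simp add: algebra_simps)
lift_definition uminus_exterior2 :: "'a exterior2 \<Rightarrow> 'a exterior2" is uminus
  by (drule exterior_ideal_uminus) (simp add: algebra_simps)
lift_definition times_exterior2 :: "'a exterior2 \<Rightarrow> 'a exterior2 \<Rightarrow> 'a exterior2" is "(*)"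
proof -
  fix f f' g g' :: "var list \<Rightarrow>\<^sub>0 'a"
  assume "f - f' \<in> exterior_ideal" "g - g' \<in> exterior_ideal"
  then have "(f - f') * g + f' * (g - g') \<in> exterior_ideal"
    by (intro exterior_ideal_add exterior_ideal_lmult exterior_ideal_rmult)
  then show "f * g - f' * g' \<in> exterior_ideal" by (simp add: algebra_simps)
qed

instance
proof
  fix a b c :: "'a exterior2"
  show "a + b + c = a + (b + c)" "0 + a = a" "- a + a = 0" "a - b = a + - b"
    by (transfer; simp add: add.assoc exterior_ideal_zero)+
  show "a + b = b + a"
    by transfer (simp add: add.commute exterior_ideal_zero)
  show "a * b * c = a * (b * c)" "1 * a = a" "a * 1 = a"
    "(a + b) * c = a * c + b * c" "a * (b + c) = a * b + a * c"
    by (transfer; simp add: mult.assoc distrib_left distrib_right exterior_ideal_zero)+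
  show "(0 :: 'a exterior2) \<noteq> 1"
  proof transfer
    have "(1 :: var list \<Rightarrow>\<^sub>0 'a) \<notin> exterior_ideal" by (rule one_notin_exterior_ideal)
    then show "\<not> (0 :: var list \<Rightarrow>\<^sub>0 'a) - 1 \<in> exterior_ideal"
      using exterior_ideal_uminus[of "0 - 1 :: var list \<Rightarrow>\<^sub>0 'a"] by auto
  qed
qed

end

lift_definition scale_exterior2 :: "'k::field \<Rightarrow> 'k exterior2 \<Rightarrow> 'k exterior2" is fscale
proof -
  fix c :: 'k and f g :: "var list \<Rightarrow>\<^sub>0 'k"
  assume "f - g \<in> exterior_ideal"
  then have "Poly_Mapping.single [] c * (f - g) \<in> exterior_ideal" by (rule exterior_ideal_lmult)
  then show "fscale c f - fscale c g \<in> exterior_ideal"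
    by (simp only: fscale_conv_mult right_diff_distrib)
qed

lift_definition generator :: "var \<Rightarrow> 'k::field exterior2" is free_var .

lemma exterior2_algebra:
  "vector_space (scale_exterior2 :: 'k::field \<Rightarrow> _)"
  "scale_exterior2 (c :: 'k) x * y = scale_exterior2 c (x * y)"
  "x * scale_exterior2 c y = scale_exterior2 c (x * y)"
proof -
  show "vector_space (scale_exterior2 :: 'k \<Rightarrow> _)"
    by unfold_locales
      (transfer; simp add: fsum.scale_right_distrib fsum.scale_left_distrib exterior_ideal_zero)+
  show "scale_exterior2 c x * y = scale_exterior2 c (x * y)"
    by transfer (simp add: fscale_mult_left exterior_ideal_zero)
  show "x * scale_exterior2 c y = scale_exterior2 c (x * y)"
    by transfer (simp add: fscale_mult_right exterior_ideal_zero)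
qed

interpretation exterior2: vector_space "scale_exterior2 :: 'k::field \<Rightarrow> _"
  by (rule exterior2_algebra)

lemma generator_relations:
  "generator X1 * generator X1 = (0 :: 'k::field exterior2)"
  "generator X2 * generator X2 = (0 :: 'k exterior2)"
  "generator X2 * generator X1 = - (generator X1 * generator X2 :: 'k exterior2)"
proof -
  have r: "{free_var X1 * free_var X1, free_var X2 * free_var X2,
      free_var X1 * free_var X2 + free_var X2 * free_var X1} \<subseteq> (exterior_ideal :: (var list \<Rightarrow>\<^sub>0 'k) set)"
    unfolding exterior_ideal_def by (rule ideal_generated_subset)
  show "generator X1 * generator X1 = (0 :: 'k exterior2)"
    by transfer (use r in simp)
  show "generator X2 * generator X2 = (0 :: 'k exterior2)"
    by transfer (use r in simp)
  show "generator X2 * generator X1 = - (generator X1 * generator X2 :: 'k exterior2)"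
    by transfer (use r in \<open>simp add: add.commute\<close>)
qed

lemma exterior2_span:
  "exterior2.span {1, generator X1, generator X2, generator X1 * generator X2}
     = (UNIV :: 'k::field exterior2 set)" (is "exterior2.span ?B = _")
proof -
  have gen: "generator v * x \<in> exterior2.span ?B" if "x \<in> exterior2.span ?B" for v and x :: "'k exterior2"
    using that
  proof (induction x rule: exterior2.span_induct_alt)
    case base
    then show ?case by (simp add: exterior2.span_zero)
  next
    case (step c b y)
    have "generator X2 * (generator X1 * generator X2)
        = generator X2 * generator X1 * (generator X2 :: 'k exterior2)"
      by (simp only: mult.assoc)
    also have "\<dots> = - (generator X1 * (generator X2 * generator X2))"
      by (simp only: generator_relations(3) mult_minus_left mult.assoc)
    finally have *: "generator X2 * (generator X1 * generator X2) = (0 :: 'k exterior2)"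
      by (simp add: generator_relations)
    have **: "generator X1 * (generator X1 * generator X2) = (0 :: 'k exterior2)"
      by (simp only: mult.assoc[symmetric] generator_relations mult_zero_left)
    have neg: "- (generator X1 * generator X2) \<in> exterior2.span ?B"
      by (rule exterior2.span_neg, rule exterior2.span_base) simp
    have "generator v * b \<in> exterior2.span ?B" using step(1)
      by (cases v) (auto simp: generator_relations * **
            intro: neg exterior2.span_base exterior2.span_zero)
    then show ?case using step(2)
      by (simp add: distrib_left exterior2_algebra exterior2.span_add exterior2.span_scale)
  qed
  have word: "abs_exterior2 (Poly_Mapping.single w 1) \<in> exterior2.span ?B" for w
  proof (induction w)
    case Nil
    have "abs_exterior2 (Poly_Mapping.single [] 1) = (1 :: 'k exterior2)"
      by (simp add: one_exterior2.abs_eq single_one[symmetric] zero_list_def del: single_one)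
    then show ?case by (simp add: exterior2.span_base)
  next
    case (Cons v w)
    have "abs_exterior2 (Poly_Mapping.single (v # w) 1)
        = (generator v * abs_exterior2 (Poly_Mapping.single w 1) :: 'k exterior2)"
      by (simp add: generator.abs_eq times_exterior2.abs_eq free_var_def mult_single plus_list_def)
    then show ?case using gen[OF Cons] by simp
  qed
  have "abs_exterior2 f \<in> exterior2.span ?B" for f :: "var list \<Rightarrow>\<^sub>0 'k"
  proof (induction f rule: poly_mapping_add_induct)
    case 1
    then show ?case by (simp add: zero_exterior2.abs_eq[symmetric] exterior2.span_zero)
  next
    case (2 p c)
    have "abs_exterior2 (Poly_Mapping.single p c)
        = scale_exterior2 c (abs_exterior2 (Poly_Mapping.single p 1))"
      by (simp add: scale_exterior2.abs_eq fscale_single)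
    then show ?case using exterior2.span_scale[OF word] by simp
  next
    case (3 f g)
    then show ?case by (simp add: plus_exterior2.abs_eq[symmetric] exterior2.span_add)
  qed
  then have "x \<in> exterior2.span ?B" for x :: "'k exterior2"
    by (induction x rule: exterior2.abs_induct)
  then show ?thesis by blast
qed

interpretation exterior2: fin_dim_algebra "scale_exterior2 :: 'k::field \<Rightarrow> _"
proof
  show "\<exists>B. finite B \<and> exterior2.span B = (UNIV :: 'k exterior2 set)"
    using exterior2_span by (metis finite.emptyI finite.insertI)
qed (rule exterior2_algebra)+

end

theory Submission
  imports Defs
begin

text \<open>
  Write \<open>x, y\<close> for the generators and \<open>z = xy\<close>.  The counit condition on \<open>S\<close> reads
  \<open>\<phi>(ta) = \<epsilon>(a)\<close>, so \<open>t\<close> is a right integral by nondegeneracy of \<open>\<phi>\<close>; in the exterior algebra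
  this makes \<open>t\<close> a nonzero multiple of \<open>z\<close>, hence a left integral too, and \<open>S t = t\<close>.  Comparing
  \<open>\<Delta>(t)\<close> with \<open>\<Delta>(S t) = \<Sum> S t\<^sub>2 \<otimes> S t\<^sub>1\<close> shows that \<open>S\<^sup>2\<close> is a Nakayama automorphism:
  \<open>\<phi>(ca) = \<phi>(S\<^sup>2(a) c)\<close>.  Let \<open>M\<close> be the matrix of \<open>S\<close> on the plane spanned by \<open>x, y\<close> modulo \<open>z\<close>.
  The Nakayama property of the exterior algebra gives \<open>M\<^sup>2 = -1\<close>, while \<open>S z = z\<close> and antimultiplicativity
  give \<open>det M = -1\<close>.  By Cayley--Hamilton \<open>(tr M) M = -2\<close>, and as the characteristic is
  not 2, \<open>M\<close> is a scalar whose square is \<open>-1\<close>.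
\<close>

section \<open>Linear extensions and tensors\<close>

text \<open>Keys outside the support contribute zero, so several formal sums can be handled over one
  common finite index set.\<close>

lemma extend_linearly_superset:
  assumes "vector_space scale" "finite B" "Poly_Mapping.keys u \<subseteq> B"
  shows "extend_linearly scale f u = (\<Sum>p\<in>B. scale (Poly_Mapping.lookup u p) (f p))"
proof -
  interpret vector_space scale by fact
  show ?thesis
    unfolding extend_linearly_def
    by (rule sum.mono_neutral_left) (use assms in \<open>auto simp: in_keys_iff\<close>)
qed

lemma linear_extend_linearly:
  fixes scale :: "'k::field \<Rightarrow> 'v::ab_group_add \<Rightarrow> 'v" and f :: "'p \<Rightarrow> 'v"
  assumes "vector_space scale"
  shows "Vector_Spaces.linear fscale scale (extend_linearly scale f)"
proof -
  interpret vector_space scale by fact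
  show ?thesis
    unfolding Vector_Spaces.linear_iff
  proof (intro conjI allI)
    fix u v :: "'p \<Rightarrow>\<^sub>0 'k"
    let ?B = "Poly_Mapping.keys u \<union> Poly_Mapping.keys v"
    have "Poly_Mapping.keys (u + v) \<subseteq> ?B" by (rule Poly_Mapping.keys_add)
    then show "extend_linearly scale f (u + v) = extend_linearly scale f u + extend_linearly scale f v"
      by (simp add: extend_linearly_superset[OF assms, where B = ?B] lookup_add scale_left_distrib
          sum.distrib)
  next
    fix c :: 'k and u :: "'p \<Rightarrow>\<^sub>0 'k"
    have "Poly_Mapping.keys (fscale c u) \<subseteq> Poly_Mapping.keys u" by (auto simp: in_keys_iff)
    then show "extend_linearly scale f (fscale c u) = scale c (extend_linearly scale f u)"
      by (simp add: extend_linearly_superset[OF assms, where B = "Poly_Mapping.keys u"]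
          scale_sum_right)
  qed (rule fsum.vector_space_axioms assms)+
qed

lemma extend_linearly_single:
  assumes "vector_space scale"
  shows "extend_linearly scale f (Poly_Mapping.single p 1) = f p"
proof -
  interpret vector_space scale by fact
  show ?thesis by (simp add: extend_linearly_def)
qed

lemma linear_comp_extend_linearly:
  assumes "Vector_Spaces.linear scale scale' h"
  shows "h (extend_linearly scale f u) = extend_linearly scale' (\<lambda>p. h (f p)) u"
proof -
  interpret Vector_Spaces.linear scale scale' h by fact
  show ?thesis by (simp add: extend_linearly_def sum scale)
qed

text \<open>Universal property of the tensor product: the extension of a bilinear map kills every
  slot relation, hence their span. It lets an identity modulo tensor relations be evaluated under
  \<beta>.\<close>

lemma tensor2_eq_bilinear:
  fixes scale :: "'k::field \<Rightarrow> 'a::ab_group_add \<Rightarrow> 'a"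
    and scale' :: "'k \<Rightarrow> 'v::ab_group_add \<Rightarrow> 'v"
  assumes "tensor2_eq scale u v"
    and left: "\<And>y. Vector_Spaces.linear scale scale' (\<lambda>x. \<beta> x y)"
    and right: "\<And>x. Vector_Spaces.linear scale scale' (\<beta> x)"
  shows "extend_linearly scale' (\<lambda>(x, y). \<beta> x y) u = extend_linearly scale' (\<lambda>(x, y). \<beta> x y) v"
proof -
  let ?h = "extend_linearly scale' (\<lambda>(x, y). \<beta> x y)"
  let ?R = "\<Union>b. slot_relations scale (\<lambda>x. (x, b)) \<union> slot_relations scale (\<lambda>x. (b, x))"
  have vs: "vector_space scale'"
    using left[of 0] by (simp add: Vector_Spaces.linear_def)
  interpret h: Vector_Spaces.linear fscale scale' ?h
    by (rule linear_extend_linearly[OF vs])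
  note simps = h.diff h.scale extend_linearly_single[OF vs]
    module_hom.add[OF Vector_Spaces.linear.axioms(3)[OF left]] module_hom.scale[OF Vector_Spaces.linear.axioms(3)[OF left]]
    module_hom.add[OF Vector_Spaces.linear.axioms(3)[OF right]] module_hom.scale[OF Vector_Spaces.linear.axioms(3)[OF right]]
  have "?h r = 0" if "r \<in> ?R" for r
    using that by (auto simp: slot_relations_def simps)
  then have "fsum.span ?R \<subseteq> {r. ?h r = 0}"
    by (intro fsum.span_minimal h.subspace_kernel) auto
  then have "?h (u - v) = 0"
    using assms(1) unfolding tensor2_eq_def by blast
  then show ?thesis by (simp add: h.diff)
qed

section \<open>The antipode of a bi-Frobenius algebra\<close>

text \<open>A nonzero vector is an independent singleton, so some functional takes the value 1 on
  it.\<close>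

lemma (in vector_space) eq_zero_if_functionals_vanish:
  assumes "\<And>f. Vector_Spaces.linear scale (*) f \<Longrightarrow> f w = 0"
  shows "w = 0"
proof (rule ccontr)
  assume "w \<noteq> 0"
  interpret vector_space_pair scale "(*) :: 'a \<Rightarrow> _"
    by unfold_locales (simp_all add: algebra_simps)
  have "\<exists>g. Vector_Spaces.linear scale (*) g \<and> (\<forall>x\<in>{w}. g x = 1)"
    using \<open>w \<noteq> 0\<close> by (intro linear_independent_extend) simp
  then show False using assms by fastforce
qed

lemma (in fin_dim_algebra) inj_if_surj:
  assumes "Vector_Spaces.linear scale scale f" "surj f"
  shows "inj f"
proof -
  obtain B where B: "finite B" "span B = UNIV" using finite_dimensional by blast
  obtain B' where "B' \<subseteq> B" "independent B'" "B \<subseteq> span B'"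
    using maximal_independent_subset[of B] by blast
  then have "finite B'" "span B' = UNIV"
    using B finite_subset span_minimal[OF _ subspace_span] by blast+
  then interpret finite_dimensional_vector_space scale B'
    using \<open>independent B'\<close> by unfold_locales
  show ?thesis using assms by (rule linear_surj_imp_inj)
qed

context bi_frobenius_algebra
begin

lemma linear_mult_right: "Vector_Spaces.linear scale scale (\<lambda>x. x * a)"
  and linear_mult_left: "Vector_Spaces.linear scale scale (\<lambda>x. a * x)"
  by (simp_all add: Vector_Spaces.linear_iff vector_space_axioms distrib_left distrib_right
      scale_mult_left scale_mult_right)

lemma linear_\<phi>_mult: "Vector_Spaces.linear scale (*) (\<lambda>x. \<phi> (x * a))"
  using Vector_Spaces.linear_compose[OF linear_mult_right \<phi>_linear] by (simp add: o_def)

lemma linear_S: "Vector_Spaces.linear scale scale S"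
proof -
  have \<phi>: "\<phi> (a + b) = \<phi> a + \<phi> b" "\<phi> (scale c a) = c * \<phi> a" for a b c
    using \<phi>_linear by (auto simp: Vector_Spaces.linear_iff)
  show ?thesis
    unfolding Vector_Spaces.linear_iff
    by (auto simp: vector_space_axioms S_eq extend_linearly_def distrib_left scale_mult_right \<phi> scale_left_distrib
        scale_right_distrib sum.distrib scale_sum_right case_prod_unfold mult.left_commute)
qed

text \<open>The two Frobenius conditions combine: each \<open>w\<close> comes from \<open>t\<close>
  and a functional \<open>f\<close>, and \<open>f\<close> is \<phi>(- a) for some \<open>a\<close>,
  which makes \<open>w\<close> equal to \<open>S a\<close>.\<close>

lemma surj_S: "surj S"
proof -
  have "w \<in> range S" for w
  proof -
    obtain f where "Vector_Spaces.linear scale (*) f"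
      "w = extend_linearly scale (\<lambda>(t1, t2). scale (f t1) t2) (\<Delta> t)"
      using frobenius_coalgebra by blast
    moreover from this obtain a where "f = (\<lambda>x. \<phi> (x * a))"
      using frobenius_algebra by blast
    ultimately show ?thesis by (metis S_eq rangeI)
  qed
  then show ?thesis by blast
qed

lemma inj_S: "inj S"
  by (rule inj_if_surj[OF linear_S surj_S])

lemma \<phi>_nondegenerate:
  assumes "\<And>a. \<phi> (w * a) = 0"
  shows "w = 0"
proof (rule eq_zero_if_functionals_vanish)
  fix f assume "Vector_Spaces.linear scale (*) f"
  then obtain a where "f = (\<lambda>x. \<phi> (x * a))"
    using frobenius_algebra by blast
  then show "f w = 0" using assms by simp
qed

text \<open>Apply \<epsilon> to the formula defining \<open>S a\<close>: the right counit law
  contracts the sum to \<phi>(t a), and \<epsilon> absorbs \<open>S\<close>.\<close>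

lemma \<phi>_integral: "\<phi> (t * a) = \<epsilon> a"
proof -
  have "\<epsilon> a = \<epsilon> (S a)" by (simp add: counit_S)
  also have "\<dots> = extend_linearly (*) (\<lambda>(x, y). \<phi> (x * a) * \<epsilon> y) (\<Delta> t)"
    using counit_linear unfolding S_eq
    by (subst linear_comp_extend_linearly[OF counit_linear])
      (simp add: case_prod_unfold Vector_Spaces.linear_iff)
  also have "\<dots> = \<phi> (extend_linearly scale (\<lambda>(x, y). scale (\<epsilon> y) x) (\<Delta> t) * a)"
    using linear_\<phi>_mult[of a]
    by (subst linear_comp_extend_linearly[OF linear_\<phi>_mult[of a]])
      (simp add: case_prod_unfold Vector_Spaces.linear_iff mult.commute)
  finally show ?thesis by (simp add: counit_right)
qed

text \<open>Both sides, multiplied on the right by any \<open>b\<close>, have \<phi>-value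
  \<epsilon>(a) \<epsilon>(b); nondegeneracy then identifies them.\<close>

lemma integral_right: "t * a = scale (\<epsilon> a) t"
proof -
  have \<phi>: "\<phi> (a - b) = \<phi> a - \<phi> b" "\<phi> (scale c a) = c * \<phi> a" for a b c
    using \<phi>_linear
    by (auto simp: module_hom.diff[OF Vector_Spaces.linear.axioms(3)] Vector_Spaces.linear_iff)
  have "t * a - scale (\<epsilon> a) t = 0"
    by (rule \<phi>_nondegenerate)
      (simp add: left_diff_distrib \<phi> scale_mult_left mult.assoc \<phi>_integral counit_mult)
  then show ?thesis by simp
qed

text \<open>For a left integral, \<phi>(t1 t) = \<epsilon>(t1) \<phi>(t) = \<epsilon>(t1), so the
  sum defining \<open>S t\<close> collapses by the left counit law.\<close>

lemma S_integral:
  assumes "\<And>a. a * t = scale (\<epsilon> a) t"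
  shows "S t = t"
proof -
  have "\<phi> t = 1" using \<phi>_integral[of 1] by (simp add: counit_one)
  then have "\<phi> (a * t) = \<epsilon> a" for a
    using \<phi>_linear by (simp add: assms Vector_Spaces.linear_iff)
  then show ?thesis using counit_left[of t] by (simp add: S_eq)
qed

lemma S_square_Nakayama:
  assumes "S t = t"
  shows "\<phi> (c * a) = \<phi> (S (S a) * c)"
proof -
  note vs = vector_space_axioms
  have \<phi>: "\<phi> (a + b) = \<phi> a + \<phi> b" "\<phi> (scale r a) = r * \<phi> a" for a b r
    using \<phi>_linear by (auto simp: Vector_Spaces.linear_iff)
  have S: "S (scale r a) = scale r (S a)" for a r
    using linear_S by (auto simp: Vector_Spaces.linear_iff)
  \<comment> \<open>Dual-basis expansion. As \<open>S t = t\<close>, \<open>comult_S\<close> gives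
    two representatives of the same tensor; under \<open>?\<beta>\<close> one yields
    \<open>S w\<close>, the other \<open>S\<close> of the claimed sum, and injectivity cancels
    \<open>S\<close>.\<close>
  have expand: "w = extend_linearly scale (\<lambda>(x, y). scale (\<phi> (S y * w)) x) (\<Delta> t)" for w
  proof (rule injD[OF inj_S])
    let ?\<beta> = "\<lambda>x y. scale (\<phi> (x * w)) y"
    have "S w = extend_linearly scale (\<lambda>(x, y). ?\<beta> x y) (\<Delta> (S t))"
      by (simp add: S_eq[of w] assms)
    also have "\<dots> = extend_linearly scale (\<lambda>(x, y). ?\<beta> x y)
        (extend_linearly fscale (\<lambda>(x, y). Poly_Mapping.single (S y, S x) 1) (\<Delta> t))"
      by (rule tensor2_eq_bilinear[OF comult_S])
        (auto simp: Vector_Spaces.linear_iff vector_space_axioms distrib_right \<phi> scale_left_distrib scale_right_distrib scale_mult_left mult.commute)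
    also have "\<dots> = extend_linearly scale (\<lambda>(x, y). scale (\<phi> (S y * w)) (S x)) (\<Delta> t)"
      by (subst linear_comp_extend_linearly[OF linear_extend_linearly[OF vs]])
        (simp add: case_prod_unfold extend_linearly_single[OF vs])
    also have "\<dots> = S (extend_linearly scale (\<lambda>(x, y). scale (\<phi> (S y * w)) x) (\<Delta> t))"
      by (simp add: linear_comp_extend_linearly[OF linear_S] case_prod_unfold S)
    finally show "S w = S (extend_linearly scale (\<lambda>(x, y). scale (\<phi> (S y * w)) x) (\<Delta> t))" .
  qed
  obtain b where b: "c = S b" using surj_S by blast
  have lin: "Vector_Spaces.linear scale (*) (\<lambda>y. \<phi> (S (b * y)))"
    using Vector_Spaces.linear_compose[OF Vector_Spaces.linear_compose[OF linear_mult_left linear_S] \<phi>_linear]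
    by (simp add: o_def)
  \<comment> \<open>Expand \<open>c\<close>, then use \<open>S y * S b = S (b * y)\<close> to move
    the second leg inside \<open>S\<close>, where the sum over \<Delta>(t) becomes
    \<open>S a\<close>.\<close>
  have "\<phi> (c * a) = extend_linearly (*) (\<lambda>(x, y). \<phi> (S y * c) * \<phi> (x * a)) (\<Delta> t)"
    by (subst expand[of c], subst linear_comp_extend_linearly[OF linear_\<phi>_mult])
      (simp add: case_prod_unfold scale_mult_left \<phi>)
  also have "\<dots> = extend_linearly (*) (\<lambda>(x, y). \<phi> (x * a) * \<phi> (S (b * y))) (\<Delta> t)"
    by (simp add: b S_mult mult.commute)
  also have "\<dots> = \<phi> (S (b * S a))"
    unfolding S_eq[of a]
    by (subst linear_comp_extend_linearly[OF lin])
      (simp add: case_prod_unfold scale_mult_right S \<phi>)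
  finally show ?thesis by (simp add: S_mult b)
qed

end

section \<open>Coordinates in the exterior algebra\<close>

lemma lookup_letter_mult:
  "Poly_Mapping.lookup (f * g) [v] =
     Poly_Mapping.lookup f [] * Poly_Mapping.lookup g [v] + Poly_Mapping.lookup f [v] * Poly_Mapping.lookup g []"
  for f g :: "'v list \<Rightarrow>\<^sub>0 'k::field"
proof (induction f rule: poly_mapping_add_induct)
  case (2 p c)
  show ?case
    by (induction g rule: poly_mapping_add_induct)
      (auto simp: mult_single plus_list_def lookup_single when_def lookup_add algebra_simps
        append_eq_Cons_conv)
qed (simp_all add: lookup_add algebra_simps)

lemma lookup_two_letters_mult:
  "Poly_Mapping.lookup (f * g) [v, w] =
     Poly_Mapping.lookup f [] * Poly_Mapping.lookup g [v, w]
     + Poly_Mapping.lookup f [v] * Poly_Mapping.lookup g [w]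
     + Poly_Mapping.lookup f [v, w] * Poly_Mapping.lookup g []"
  for f g :: "'v list \<Rightarrow>\<^sub>0 'k::field"
proof (induction f rule: poly_mapping_add_induct)
  case (2 p c)
  show ?case
    by (induction g rule: poly_mapping_add_induct)
      (auto simp: mult_single plus_list_def lookup_single when_def lookup_add algebra_simps
        append_eq_Cons_conv)
qed (simp_all add: lookup_add algebra_simps)

text \<open>The witness \<open>?I\<close> contains the relations but not x1 x2. Elements of
  \<open>?I\<close> have no terms of degree below 2, so multiplication only rescales their degree-2
  coefficients by a constant term and preserves the symmetry condition.\<close>

lemma generator_product_nonzero: "generator X1 * generator X2 \<noteq> (0 :: 'k::field exterior2)"
proof transfer
  let ?L = "Poly_Mapping.lookup :: (var list \<Rightarrow>\<^sub>0 'k) \<Rightarrow> _"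
  let ?I = "{f. ?L f [] = 0 \<and> (\<forall>v. ?L f [v] = 0) \<and> ?L f [X1, X2] = ?L f [X2, X1]}"
  have "exterior_ideal \<subseteq> ?I" unfolding exterior_ideal_def
    by (rule ideal_generated_least)
      (auto simp: two_sided_ideal_def lookup_minus lookup_add lookup_Nil_mult lookup_letter_mult
        lookup_two_letters_mult free_var_def lookup_single when_def)
  moreover have "free_var X1 * free_var X2 - 0 \<notin> ?I"
    by (simp add: lookup_two_letters_mult free_var_def lookup_single)
  ultimately show "\<not> free_var X1 * free_var X2 - 0 \<in> (exterior_ideal :: (var list \<Rightarrow>\<^sub>0 'k) set)"
    by blast
qed

theorem proposition5p4:
  assumes "\<nexists>i :: 'k::field. i\<^sup>2 = - 1"
  shows "\<nexists>\<Delta> \<epsilon> \<phi> t S. bi_frobenius_algebra (scale_exterior2 :: 'k \<Rightarrow> 'k exterior2 \<Rightarrow> 'k exterior2) \<Delta> \<epsilon> \<phi> t S"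
proof (intro notI, elim exE)
  fix \<Delta> \<epsilon> \<phi> t S
  assume "bi_frobenius_algebra (scale_exterior2 :: 'k \<Rightarrow> 'k exterior2 \<Rightarrow> 'k exterior2) \<Delta> \<epsilon> \<phi> t S"
  then interpret bi_frobenius_algebra "scale_exterior2 :: 'k \<Rightarrow> _" \<Delta> \<epsilon> \<phi> t S .

  \<comment> \<open>Multiplication table and coordinates with respect to
    \<open>1, x, y, z\<close>\<close>
  define x y z where xyz: "x = (generator X1 :: 'k exterior2)" "y = (generator X2 :: 'k exterior2)" "z = x * y"
  let ?s = "scale_exterior2 :: 'k \<Rightarrow> _"
  have zn: "z \<noteq> 0" using generator_product_nonzero by (simp add: xyz)
  have [simp]: "x * x = 0" "y * y = 0" "x * y = z" "y * x = - z"
    using generator_relations by (simp_all add: xyz)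
  have [simp]: "x * z = 0" "z * y = 0"
    by (metis \<open>x * x = 0\<close> xyz(3) mult.assoc mult_zero_left,
        metis \<open>y * y = 0\<close> xyz(3) mult.assoc mult_zero_right)
  have [simp]: "y * z = 0" "z * x = 0"
    by (metis \<open>y * x = - z\<close> \<open>z * y = 0\<close> xyz(3) mult.assoc mult_minus_left minus_zero,
        metis \<open>y * x = - z\<close> \<open>x * z = 0\<close> xyz(3) mult.assoc mult_minus_right minus_zero)
  have [simp]: "z * z = 0" by (metis \<open>y * z = 0\<close> xyz(3) mult.assoc mult_zero_right)
  note lin_simps = distrib_left distrib_right exterior2_algebra(2,3) exterior2.scale_right_distrib
    exterior2.scale_left_distrib exterior2.scale_minus_right
  have coords: "\<exists>a b c d. w = ?s a 1 + ?s b x + ?s c y + ?s d z" for w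
  proof -
    have "w \<in> exterior2.span {1, x, y, z}" unfolding xyz exterior2_span by simp
    then show ?thesis
      by (auto simp: exterior2.span_insert algebra_simps)
  qed
  have \<epsilon>: "\<epsilon> (a + b) = \<epsilon> a + \<epsilon> b" "\<epsilon> (?s r a) = r * \<epsilon> a" "\<epsilon> 0 = 0" for a b r
    using counit_linear by (auto simp: Vector_Spaces.linear_iff module_hom.zero[OF Vector_Spaces.linear.axioms(3)])
  have \<phi>: "\<phi> (a + b) = \<phi> a + \<phi> b" "\<phi> (?s r a) = r * \<phi> a" "\<phi> 0 = 0" "\<phi> (- a) = - \<phi> a"
    "\<phi> (a - b) = \<phi> a - \<phi> b" for a b r
    using \<phi>_linear
    by (auto simp: Vector_Spaces.linear_iff module_hom.zero[OF Vector_Spaces.linear.axioms(3)]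
        module_hom.neg[OF Vector_Spaces.linear.axioms(3)] module_hom.diff[OF Vector_Spaces.linear.axioms(3)])
  have S: "S (a + b) = S a + S b" "S (?s r a) = ?s r (S a)" for a b r
    using linear_S by (auto simp: Vector_Spaces.linear_iff)

  \<comment> \<open>The counit on the generators and the integral \<open>t\<close>\<close>
  have [simp]: "\<epsilon> x = 0" "\<epsilon> y = 0"
    using counit_mult[of x x] counit_mult[of y y] by (simp_all add: \<epsilon>)
  have [simp]: "\<epsilon> z = 0" using counit_mult[of x y] by simp
  obtain c where t: "t = ?s c z"
  proof -
    obtain a b c d where t: "t = ?s a 1 + ?s b x + ?s c y + ?s d z" using coords by blast
    \<comment> \<open>These products are \<open>a z\<close>, \<open>a x - c z\<close> and
      \<open>a y + b z\<close>, so they remove all coordinates of \<open>t\<close> but the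
      last.\<close>
    have "t * z = 0" "t * x = 0" "t * y = 0" by (simp_all add: integral_right)
    then have "a = 0" "c = 0" "b = 0" using zn by (auto simp: t lin_simps)
    then show ?thesis using that[of d] t by simp
  qed
  have "\<phi> t = 1" using \<phi>_integral[of 1] by (simp add: counit_one)
  then have cn: "c \<noteq> 0" "\<phi> z \<noteq> 0" by (auto simp: t \<phi>)
  \<comment> \<open>The elements \<open>x\<close>, \<open>y\<close>, \<open>z\<close> annihilate
    \<open>z\<close> from the left, so only the constant term of \<open>a\<close>, which is
    \<epsilon>(a), survives.\<close>
  have "a * t = ?s (\<epsilon> a) t" for a
    using coords[of a] by (auto simp: t lin_simps \<epsilon> counit_one mult.commute)
  then have St: "S t = t" by (rule S_integral)
  then have Sz: "S z = z" using cn by (simp add: t S)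

  \<comment> \<open>The matrix of \<open>S\<close> on \<open>x\<close>, \<open>y\<close> modulo
    \<open>z\<close>\<close>
  obtain \<alpha> \<beta> \<gamma> where Sx: "S x = ?s \<alpha> x + ?s \<beta> y + ?s \<gamma> z"
  proof -
    obtain a b c d where *: "S x = ?s a 1 + ?s b x + ?s c y + ?s d z" using coords by blast
    moreover have "\<epsilon> (S x) = 0" by (simp add: counit_S)
    ultimately have "a = 0" by (simp add: \<epsilon> counit_one)
    then show ?thesis using that * by simp
  qed
  obtain \<alpha>' \<beta>' \<gamma>' where Sy: "S y = ?s \<alpha>' x + ?s \<beta>' y + ?s \<gamma>' z"
  proof -
    obtain a b c d where *: "S y = ?s a 1 + ?s b x + ?s c y + ?s d z" using coords by blast
    moreover have "\<epsilon> (S y) = 0" by (simp add: counit_S)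
    ultimately have "a = 0" by (simp add: \<epsilon> counit_one)
    then show ?thesis using that * by simp
  qed
  \<comment> \<open>The product of \<open>S y\<close> and \<open>S x\<close> is minus the
    determinant times \<open>z\<close>, since \<open>y x = -z\<close>.\<close>
  have "\<phi> (S y * S x) = \<phi> z" using S_mult[of x y] Sz by simp
  then have "(\<alpha>' * \<beta> - \<beta>' * \<alpha>) * \<phi> z = 1 * \<phi> z"
    by (simp add: Sx Sy lin_simps \<phi> algebra_simps)
  then have det: "\<alpha>' * \<beta> - \<beta>' * \<alpha> = 1" using cn by (simp only: mult_cancel_right) simp
  note N = S_square_Nakayama[OF St]
  \<comment> \<open>Pairing \<open>S (S x)\<close> with \<open>y\<close> isolates its
    \<open>x\<close>-coefficient, and pairing it with \<open>x\<close> below isolates its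
    \<open>y\<close>-coefficient; multiples of \<open>z\<close> die in both products. This is the
    first row of the square of the matrix.\<close>
  have "(\<alpha> * \<alpha> + \<beta> * \<alpha>') * \<phi> z = -1 * \<phi> z"
    using N[of y x] by (simp add: Sx Sy Sz S lin_simps \<phi> algebra_simps)
  then have 1: "\<alpha> * \<alpha> + \<beta> * \<alpha>' = -1" using cn by (simp only: mult_cancel_right) simp
  have "\<beta> * (\<alpha> + \<beta>') * \<phi> z = 0"
    using N[of x x] by (simp add: Sx Sy Sz S lin_simps \<phi> algebra_simps)
  then have 2: "\<beta> = 0 \<or> \<alpha> + \<beta>' = 0" using cn by simp
  \<comment> \<open>In characteristic 2, the element 1 would be a square root of -1.\<close>
  have two: "(2 :: 'k) \<noteq> 0"
  proof
    assume "(2 :: 'k) = 0"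
    then have "(1 :: 'k)\<^sup>2 = - 1" by (simp add: eq_neg_iff_add_eq_0)
    then show False using assms by blast
  qed
  have "\<alpha>\<^sup>2 = - 1"
    using 2
  proof
    assume "\<beta> = 0"
    then show ?thesis using 1 by (simp add: power2_eq_square)
  next
    \<comment> \<open>With trace zero, determinant -1 forces the square of the matrix to be 1, which
      contradicts its diagonal entry -1.\<close>
    assume "\<alpha> + \<beta>' = 0"
    then have "\<beta>' = - \<alpha>" by (simp add: eq_neg_iff_add_eq_0 add.commute)
    then have "\<alpha> * \<alpha> + \<beta> * \<alpha>' = 1" using det by (simp add: algebra_simps)
    then have "(2 :: 'k) = 0" using 1 by (metis add.right_inverse one_add_one)
    then show ?thesis using two by contradiction
  qed
  then show False using assms by blast
qed

end
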